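(* Suppose $p$ is affine and the buyer observes the object's profitability with probability $\tau\in[0,1]$. If $\tau=1$, the seller optimally acquires the least precise signal, that is, $\theta=0$. Moreover, if $\tau>\tau'$ and $\theta$ and $\theta'$ are signal precisions optimally acquired under transparency policies $\tau$ and $\tau'$ respectively, then $\theta\le\theta'$.
   Context: Let $\mathcal X=[x_{min},x_{max}]$ and $\mathcal Y=[y_{min},y_{max}]$ be compact intervals with $y_{min}\ge 0$. An object has a value to a buyer in $\mathcal X$ and a profitability $y\in\mathcal Y$ to a seller; their joint distribution and its marginals have no mass points, and $F_Y$ is the marginal cdf of $y$. The demand function $p:\mathcal X\to[0,1]$ is strictly increasing and differentiable (here affine): $p(\hat x)$ is the purchase probability when the buyer's posterior mean of the value is $\hat x$. Signals about the value are indexed by precision $\theta\in\mathbb R_+$ and cost $c(\theta)$, with $c$ strictly increasing. The signal of precision $\theta$ yields, conditional on $y$, a realization $x$ with cdf $F_{X|y}(\cdot,\theta)$; a realization is identified with the posterior mean of the value it induces, which does not depend on $y$. Assumptions: (i) for every $\theta$ and every $y\in\mathcal Y$, $F_{X|y}(\cdot,\theta)$ has full support over some interval $\mathcal X(\theta)\subseteq\mathcal X$; (ii) if $\theta'>\theta$ then for every $y\in\mathcal Y$, $F_{X|y}(\cdot,\theta')$ is a mean-preserving spread of $F_{X|y}(\cdot,\theta)$; (iii) for every $y\in\mathcal Y$, $F_{X|y}(\cdot,0)$ is degenerate. Before anything is realized, the seller overtly chooses $\theta$ and commits to a disclosure rule, i.e. a measurable map $d$ assigning to each $(x,y)\in\mathcal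 X\times\mathcal Y$ a disclosure probability in $[0,1]$. Write $F_{X|y}=F_{X|y}(\cdot,\theta)$ and $$x^{ND}=\frac{\int_{\mathcal Y}\int_{\mathcal X}x(1-d(x,y))\,dF_{X|y}(x)\,dF_Y(y)}{\int_{\mathcal Y}\int_{\mathcal X}(1-d(x,y))\,dF_{X|y}(x)\,dF_Y(y)},\qquad x^{ND}_y=\frac{\int_{\mathcal X}x(1-d(x,y))\,dF_{X|y}(x)}{\int_{\mathcal X}(1-d(x,y))\,dF_{X|y}(x)}$$ (fixed at some value in $\mathcal X$ when the denominator is zero). The seller's gross payoff is $$\Pi_\tau(d,\theta)=\int_{\mathcal Y}y\int_{\mathcal X}\left[d(x,y)p(x)+(1-d(x,y))\big(\tau p(x^{ND}_y)+(1-\tau)p(x^{ND})\big)\right]dF_{X|y}(x)\,dF_Y(y).$$ A precision $\theta$ is optimally acquired under $\tau$ if, for some $d$, the pair $(d,\theta)$ maximizes $\Pi_\tau(d,\theta)-c(\theta)$ over all disclosure rules and all precisions in $\mathbb R_+$. *)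

theory Defs
  imports "HOL-Probability.Probability"
begin

definition full_support_on :: "real measure \<Rightarrow> real set \<Rightarrow> bool" where
  "full_support_on M I \<longleftrightarrow>
     emeasure M (- I) = 0 \<and> (\<forall>U. open U \<and> U \<inter> I \<noteq> {} \<longrightarrow> 0 < emeasure M U)"

text \<open>\<open>M'\<close> arises from \<open>M\<close> by replacing each outcome \<open>x\<close> with a random outcome of mean \<open>x\<close>.
  The spread may be trivial.\<close>

definition mean_preserving_spread :: "real measure \<Rightarrow> real measure \<Rightarrow> bool" where
  "mean_preserving_spread M' M \<longleftrightarrow>
     (\<exists>\<kappa> \<in> borel \<rightarrow>\<^sub>M prob_algebra borel.
        (AE x in M. integrable (\<kappa> x) (\<lambda>z. z) \<and> (\<integral>z. z \<partial>\<kappa> x) = x) \<and> M' = M \<bind> \<kappa>)"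

text \<open>\<open>prior\<close> is the joint law of (value, profitability), and \<open>signal \<theta> y\<close> is the law with cdf
  \<open>F\<^sub>X\<^sub>|\<^sub>y(\<sqdot>, \<theta>)\<close>. The last two fields are the values assigned to the two no-disclosure
  posterior means when their denominators vanish.\<close>

record env =
  xmin :: real
  xmax :: real
  ymin :: real
  ymax :: real
  prior :: "(real \<times> real) measure"
  signal :: "real \<Rightarrow> real \<Rightarrow> real measure"
  demand :: "real \<Rightarrow> real"
  cost :: "real \<Rightarrow> real"
  offpath :: real
  offpath_at :: "real \<Rightarrow> real"

abbreviation value_range :: "env \<Rightarrow> real set" where
  "value_range E \<equiv> {xmin E..xmax E}"

abbreviation profit_range :: "env \<Rightarrow> real set" where
  "profit_range E \<equiv> {ymin E..ymax E}"

definition profit_law :: "env \<Rightarrow> real measure" where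
  "profit_law E = distr (prior E) borel snd"

text \<open>There is a joint law of ((value, profitability), realization) in which \<open>signal E \<theta>\<close> is the
  conditional law of the realization given the profitability, and the conditional mean of the
  value given realization and profitability is the realization itself. The tower property gives
  the same conditional mean given the realization alone.\<close>

definition posterior_mean_signal :: "env \<Rightarrow> real \<Rightarrow> bool" where
  "posterior_mean_signal E \<theta> \<longleftrightarrow>
     (\<exists>L :: ((real \<times> real) \<times> real) measure.
        prob_space L \<and> sets L = sets borel \<and>
        distr L borel fst = prior E \<and>
        (\<forall>B \<in> sets borel. \<forall>C \<in> sets borel.
           measure L {w. snd (fst w) \<in> B \<and> snd w \<in> C} =
             (LINT y:B \<inter> profit_range E|profit_law E. measure (signal E \<theta> y) C)) \<and>
        (AE w in L.
           real_cond_exp L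
             (vimage_algebra UNIV (\<lambda>w. (snd w, snd (fst w))) (borel :: (real \<times> real) measure))
             (\<lambda>w. fst (fst w)) w = snd w))"

locale disclosure_env =
  fixes E :: env
  assumes values_nonempty: "xmin E \<le> xmax E"
    and profits_nonempty: "ymin E \<le> ymax E"
    and profits_nonneg: "0 \<le> ymin E"
    and prior_prob: "prob_space (prior E)"
    and prior_sets: "sets (prior E) = sets borel"
    and prior_range: "AE w in prior E. w \<in> value_range E \<times> profit_range E"
    and prior_no_atoms: "\<And>w. emeasure (prior E) {w} = 0"
    and value_no_atoms: "\<And>v. emeasure (distr (prior E) borel fst) {v} = 0"
    and profit_no_atoms: "\<And>y. emeasure (profit_law E) {y} = 0"
    and demand_range: "\<And>x. x \<in> value_range E \<Longrightarrow> demand E x \<in> {0..1}"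
    and demand_strict_mono: "strict_mono_on (value_range E) (demand E)"
    and demand_differentiable: "demand E differentiable_on value_range E"
    and cost_strict_mono: "strict_mono_on {0..} (cost E)"
    and signal_kernel:
      "\<And>\<theta>. 0 \<le> \<theta> \<Longrightarrow> signal E \<theta> \<in> restrict_space borel (profit_range E) \<rightarrow>\<^sub>M prob_algebra borel"
    and signal_posterior_mean: "\<And>\<theta>. 0 \<le> \<theta> \<Longrightarrow> posterior_mean_signal E \<theta>"
    and signal_full_support:
      "\<And>\<theta> y. 0 \<le> \<theta> \<Longrightarrow> y \<in> profit_range E \<Longrightarrow>
         \<exists>I. is_interval I \<and> I \<subseteq> value_range E \<and> full_support_on (signal E \<theta> y) I"
    and signal_spread:
      "\<And>\<theta> \<theta>' y. 0 \<le> \<theta> \<Longrightarrow> \<theta> < \<theta>' \<Longrightarrow> y \<in> profit_range E \<Longrightarrow>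
         mean_preserving_spread (signal E \<theta>' y) (signal E \<theta> y)"
    and signal_zero: "\<And>y. y \<in> profit_range E \<Longrightarrow> \<exists>a. signal E 0 y = return borel a"
    and offpath_range: "offpath E \<in> value_range E"
    and offpath_at_range: "\<And>y. y \<in> profit_range E \<Longrightarrow> offpath_at E y \<in> value_range E"

definition disclosure_rules :: "env \<Rightarrow> (real \<times> real \<Rightarrow> real) set" where
  "disclosure_rules E =
     {d. d \<in> borel_measurable (restrict_space borel (value_range E \<times> profit_range E)) \<and>
         (\<forall>w \<in> value_range E \<times> profit_range E. d w \<in> {0..1})}"

definition x_ND :: "env \<Rightarrow> (real \<times> real \<Rightarrow> real) \<Rightarrow> real \<Rightarrow> real" where
  "x_ND E d \<theta> =
     (let num = (LINT y:profit_range E|profit_law E. LINT x:value_range E|signal E \<theta> y. x * (1 - d (x, y)));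
          den = (LINT y:profit_range E|profit_law E. LINT x:value_range E|signal E \<theta> y. 1 - d (x, y))
      in if den = 0 then offpath E else num / den)"

definition x_ND_at :: "env \<Rightarrow> (real \<times> real \<Rightarrow> real) \<Rightarrow> real \<Rightarrow> real \<Rightarrow> real" where
  "x_ND_at E d \<theta> y =
     (let num = (LINT x:value_range E|signal E \<theta> y. x * (1 - d (x, y)));
          den = (LINT x:value_range E|signal E \<theta> y. 1 - d (x, y))
      in if den = 0 then offpath_at E y else num / den)"

definition gross_payoff :: "env \<Rightarrow> real \<Rightarrow> (real \<times> real \<Rightarrow> real) \<Rightarrow> real \<Rightarrow> real" where
  "gross_payoff E \<tau> d \<theta> =
     (LINT y:profit_range E|profit_law E. y *
        (LINT x:value_range E|signal E \<theta> y.
           d (x, y) * demand E x +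
           (1 - d (x, y)) *
             (\<tau> * demand E (x_ND_at E d \<theta> y) + (1 - \<tau>) * demand E (x_ND E d \<theta>))))"

definition optimally_acquired :: "env \<Rightarrow> real \<Rightarrow> real \<Rightarrow> bool" where
  "optimally_acquired E \<tau> \<theta> \<longleftrightarrow>
     0 \<le> \<theta> \<and>
     (\<exists>d \<in> disclosure_rules E. \<forall>d' \<in> disclosure_rules E. \<forall>\<theta>' \<ge> 0.
        gross_payoff E \<tau> d' \<theta>' - cost E \<theta>' \<le> gross_payoff E \<tau> d \<theta> - cost E \<theta>)"

end

theory Submission
  imports Defs
begin

text \<open>For affine demand the payment \<open>\<tau> p(x\<^sup>N\<^sup>D\<^sub>y)\<close> for undisclosed objects is, given \<open>y\<close>, worth
  exactly \<open>\<tau>\<close> times what disclosing them would be worth. Hence the payoff splits as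
  \<open>K + (1 - \<tau>) G(d, \<theta>)\<close>, where \<open>G\<close> does not depend on \<open>\<tau>\<close>, and \<open>K\<close> depends only on the conditional
  means \<open>E[x | y]\<close>, which mean-preserving spreads do not change. For \<open>\<tau> = 1\<close> only the cost is left.
  For \<open>\<tau>' < \<tau>\<close>, adding the two optimality inequalities shows that \<open>G\<close> is at least as large at
  the optimum for \<open>\<tau>'\<close>, and then optimality under \<open>\<tau>\<close> forces the cost there to be at least
  as large.\<close>

section \<open>Kernel integrals and mean-preserving spreads\<close>

lemma integral_measurable_subprob_algebra2:
  fixes f :: "'a \<Rightarrow> 'b \<Rightarrow> 'c::{banach, second_countable_topology}"
  assumes f [measurable]: "(\<lambda>(x, y). f x y) \<in> borel_measurable (M \<Otimes>\<^sub>M N)"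
    and L [measurable]: "L \<in> M \<rightarrow>\<^sub>M subprob_algebra N"
  shows "(\<lambda>x. integral\<^sup>L (L x) (f x)) \<in> borel_measurable M"
proof -
  note measurable_distr2 [measurable]
  \<comment> \<open>Pushing \<open>L x\<close> forward along \<open>y \<mapsto> (x, y)\<close> moves
    the parameter into the measure, so that the integrand becomes one fixed function on the
    product.\<close>
  have "(\<lambda>x. integral\<^sup>L (distr (L x) (M \<Otimes>\<^sub>M N) (\<lambda>y. (x, y))) (\<lambda>(x, y). f x y)) \<in> borel_measurable M"
    by measurable
  then show ?thesis
    by (rule measurable_cong [THEN iffD1, rotated]) (simp add: integral_distr)
qed

lemma abs_le_of_mem_interval:
  fixes x :: real
  assumes "x \<in> {l..u}"
  shows "\<bar>x\<bar> \<le> \<bar>l\<bar> + \<bar>u\<bar>"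
  using assms by auto

text \<open>Tower property: integrating over \<open>M \<bind> \<kappa>\<close> first integrates over
  \<open>\<kappa> x\<close>, whose mean is \<open>x\<close>. Truncating to the interval makes the
  integrand bounded, as exchanging integral and bind requires, and changes nothing almost
  everywhere.\<close>

lemma set_integral_spread_eq:
  assumes "mean_preserving_spread M' M"
    and M: "prob_space M" "sets M = sets borel"
    and M': "AE x in M'. x \<in> {l..u}"
    and AE_M: "AE x in M. x \<in> {l..u}"
  shows "(LINT x:{l..u}|M'. x) = (LINT x:{l..u}|M. x)"
proof -
  interpret M: prob_space M by fact
  obtain \<kappa> where \<kappa>0: "\<kappa> \<in> borel \<rightarrow>\<^sub>M prob_algebra borel"
    and mean: "AE x in M. integrable (\<kappa> x) (\<lambda>z. z) \<and> (\<integral>z. z \<partial>\<kappa> x) = x"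
    and eq: "M' = M \<bind> \<kappa>"
    using assms(1) unfolding mean_preserving_spread_def by blast
  have \<kappa>: "\<kappa> \<in> M \<rightarrow>\<^sub>M subprob_algebra borel"
    using measurable_prob_algebraD[OF \<kappa>0] measurable_cong_sets[OF M(2) refl] by blast
  have prob: "prob_space (\<kappa> x)" and sets: "sets (\<kappa> x) = sets borel" for x
    using measurable_space[OF \<kappa>0, of x] by (simp_all add: space_prob_algebra)
  let ?f = "\<lambda>z. indicator {l..u} z *\<^sub>R z :: real"
  \<comment> \<open>A property almost sure under the mixture is almost sure under almost every
    component, so truncation leaves the mean of \<open>\<kappa> x\<close> intact.\<close>
  have "AE x in M. AE z in \<kappa> x. z \<in> {l..u}"
    using M' AE_bind[OF \<kappa>, of "\<lambda>z. z \<in> {l..u}"] unfolding eq by simp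
  then have "AE x in M. (\<integral>z. ?f z \<partial>\<kappa> x) = ?f x"
    using mean AE_M
  proof eventually_elim
    case (elim x)
    have "(\<integral>z. ?f z \<partial>\<kappa> x) = (\<integral>z. z \<partial>\<kappa> x)"
      using elim(1) by (intro integral_cong_AE) (auto simp: measurable_cong_sets[OF sets refl])
    then show ?case
      using elim by simp
  qed
  moreover have "(\<integral>z. ?f z \<partial>M') = (\<integral>x. (\<integral>z. ?f z \<partial>\<kappa> x) \<partial>M)"
    unfolding eq
  proof (rule integral_bind[where K = borel and B = "\<bar>l\<bar> + \<bar>u\<bar>" and B' = 1])
    show "\<bar>?f x\<bar> \<le> \<bar>l\<bar> + \<bar>u\<bar>" for x
      by (auto split: split_indicator)
    show "AE x in M. emeasure (\<kappa> x) (space (\<kappa> x)) \<le> ennreal 1"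
      by (simp add: prob_space.emeasure_space_1[OF prob])
  qed (use \<kappa> in \<open>auto intro: M.finite_measure\<close>)
  moreover have "(\<lambda>x. \<integral>z. ?f z \<partial>\<kappa> x) \<in> borel_measurable M"
    by (rule measurable_compose[OF \<kappa> integral_measurable_subprob_algebra]) simp
  ultimately show ?thesis
    unfolding set_lebesgue_integral_def
    by (auto intro!: integral_cong_AE simp: measurable_cong_sets[OF M(2) refl])
qed

context disclosure_env
begin

section \<open>Signal laws and integrability\<close>

lemma prob_space_profit_law: "prob_space (profit_law E)"
  unfolding profit_law_def
  by (rule prob_space.prob_space_distr[OF prior_prob])
    (simp add: measurable_cong_sets[OF prior_sets refl] borel_prod[symmetric])

lemma sets_profit_law: "sets (profit_law E) = sets borel"
  by (simp add: profit_law_def)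

text \<open>The first two facts come from the kernel assumption. For the third, the supporting
  interval is Borel, lies in \<open>value_range E\<close> and has a null complement.\<close>

lemma signal_law:
  assumes "0 \<le> \<theta>" "y \<in> profit_range E"
  shows prob_space_signal: "prob_space (signal E \<theta> y)"
    and sets_signal: "sets (signal E \<theta> y) = sets borel"
    and AE_signal: "AE x in signal E \<theta> y. x \<in> value_range E"
proof -
  have "signal E \<theta> y \<in> space (prob_algebra borel)"
    using measurable_space[OF signal_kernel[OF assms(1)]] assms(2)
    by (simp add: space_restrict_space)
  then show "prob_space (signal E \<theta> y)" and s: "sets (signal E \<theta> y) = sets borel"
    by (simp_all add: space_prob_algebra)
  obtain I where I: "is_interval I" "I \<subseteq> value_range E" "emeasure (signal E \<theta> y) (- I) = 0"
    using signal_full_support[OF assms] unfolding full_support_on_def by blast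
  have "- I \<in> sets (signal E \<theta> y)"
    unfolding s using I(1)
    by (intro borel_comp real_interval_borel_measurable)
  then have "- I \<in> null_sets (signal E \<theta> y)"
    using I(3) by blast
  then show "AE x in signal E \<theta> y. x \<in> value_range E"
    by (rule AE_I') (use I(2) in auto)
qed

lemma measure_signal_value_range:
  assumes "0 \<le> \<theta>" "y \<in> profit_range E"
  shows "measure (signal E \<theta> y) (value_range E) = 1"
  using prob_space.prob_eq_1[OF prob_space_signal[OF assms], of "value_range E"]
    AE_signal[OF assms] sets_signal[OF assms] by simp

text \<open>Boundedness suffices because all laws involved are probability measures. The second
  claim carries the factor \<open>y\<close> of the payoff, itself bounded on
  \<open>profit_range E\<close>.\<close>

lemma signal_integrable:
  fixes h :: "real \<times> real \<Rightarrow> real"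
  assumes h: "h \<in> borel_measurable (restrict_space borel (value_range E \<times> profit_range E))"
    and bound: "\<And>w. w \<in> value_range E \<times> profit_range E \<Longrightarrow> \<bar>h w\<bar> \<le> B"
    and \<theta>: "0 \<le> \<theta>"
  shows set_integrable_signal:
      "y \<in> profit_range E \<Longrightarrow> set_integrable (signal E \<theta> y) (value_range E) (\<lambda>x. h (x, y))"
    and set_integrable_profit_law:
      "set_integrable (profit_law E) (profit_range E)
        (\<lambda>y. y * (LINT x:value_range E|signal E \<theta> y. h (x, y)))"
proof -
  \<comment> \<open>Extension by zero turns measurability on the rectangle into measurability on the
    whole plane, where sections and kernel integrals are available.\<close>
  define H where "H w = indicator (value_range E \<times> profit_range E) w *\<^sub>R h w" for w
  have H: "H \<in> borel_measurable (borel \<Otimes>\<^sub>M borel)"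
    using h unfolding H_def by (simp add: borel_measurable_restrict_space_iff borel_prod borel_Times)
  have H_at: "indicator (value_range E) x *\<^sub>R h (x, y) = H (x, y)" if "y \<in> profit_range E" for x y
    using that by (simp add: H_def indicator_times)
  have B: "\<bar>H w\<bar> \<le> \<bar>B\<bar>" for w
    using bound[of w] by (auto simp: H_def split: split_indicator)
  have int: "integrable (signal E \<theta> y) (\<lambda>x. H (x, y))" if y: "y \<in> profit_range E" for y
  proof -
    interpret prob_space "signal E \<theta> y"
      using prob_space_signal[OF \<theta> y] .
    have [measurable_cong]: "sets (signal E \<theta> y) = sets borel"
      using sets_signal[OF \<theta> y] .
    note H [measurable]
    show ?thesis
      using B by (intro integrable_const_bound[where B = "\<bar>B\<bar>"]) auto
  qed
  show "set_integrable (signal E \<theta> y) (value_range E) (\<lambda>x. h (x, y))" if "y \<in> profit_range E"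
    unfolding set_integrable_def H_at[OF that] by (rule int[OF that])
  have le: "\<bar>\<integral>x. H (x, y) \<partial>signal E \<theta> y\<bar> \<le> \<bar>B\<bar>" if y: "y \<in> profit_range E" for y
  proof -
    interpret prob_space "signal E \<theta> y"
      using prob_space_signal[OF \<theta> y] .
    have "\<bar>\<integral>x. H (x, y) \<partial>signal E \<theta> y\<bar> \<le> (\<integral>x. \<bar>H (x, y)\<bar> \<partial>signal E \<theta> y)"
      by (rule integral_abs_bound)
    also have "\<dots> \<le> (\<integral>x. \<bar>B\<bar> \<partial>signal E \<theta> y)"
      using int[OF y] B by (intro integral_mono) auto
    finally show ?thesis
      by (simp add: prob_space)
  qed
  let ?J = "\<lambda>y. y * (\<integral>x. H (x, y) \<partial>signal E \<theta> y)"
  have J: "?J \<in> borel_measurable (restrict_space borel (profit_range E))"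
  proof -
    \<comment> \<open>The coordinates are swapped because the kernel is indexed by \<open>y\<close>.
      The index space stays restricted, as the signal is a kernel only on
      \<open>profit_range E\<close>.\<close>
    have "(\<lambda>p. H (snd p, fst p)) \<in> borel_measurable (restrict_space borel (profit_range E) \<Otimes>\<^sub>M borel)"
      by (rule measurable_compose[OF _ H])
        (intro measurable_Pair measurable_snd measurable_compose[OF measurable_fst]
          measurable_restrict_space1 measurable_ident_sets refl)
    then have "(\<lambda>(y, x). H (x, y)) \<in> borel_measurable (restrict_space borel (profit_range E) \<Otimes>\<^sub>M borel)"
      by (simp add: case_prod_beta)
    then have "(\<lambda>y. \<integral>x. H (x, y) \<partial>signal E \<theta> y) \<in> borel_measurable (restrict_space borel (profit_range E))"
      by (rule integral_measurable_subprob_algebra2[OF _ measurable_prob_algebraD[OF signal_kernel[OF \<theta>]]])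
    then show ?thesis
      by (rule borel_measurable_times[rotated])
        (intro measurable_restrict_space1 measurable_ident_sets refl)
  qed
  interpret prob_space "profit_law E"
    by (rule prob_space_profit_law)
  let ?C = "(\<bar>ymin E\<bar> + \<bar>ymax E\<bar>) * \<bar>B\<bar>"
  have C: "\<bar>?J y\<bar> \<le> ?C" if y: "y \<in> profit_range E" for y
    unfolding abs_mult using abs_le_of_mem_interval[OF y] le[OF y] by (intro mult_mono) auto
  have "set_integrable (profit_law E) (profit_range E) ?J"
    unfolding set_integrable_def
  proof (rule integrable_const_bound[where B = ?C])
    show "AE y in profit_law E. norm (indicator (profit_range E) y *\<^sub>R ?J y) \<le> ?C"
      using C by (auto split: split_indicator)
    show "(\<lambda>y. indicator (profit_range E) y *\<^sub>R ?J y) \<in> borel_measurable (profit_law E)"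
      using J by (simp add: borel_measurable_restrict_space_iff measurable_cong_sets[OF sets_profit_law refl])
  qed
  then show "set_integrable (profit_law E) (profit_range E)
      (\<lambda>y. y * (LINT x:value_range E|signal E \<theta> y. h (x, y)))"
    by (rule set_integrable_cong[THEN iffD1, rotated -1])
      (simp_all only: set_lebesgue_integral_def H_at)
qed

section \<open>Conditional means and undisclosed realizations\<close>

definition mean_value :: "real \<Rightarrow> real \<Rightarrow> real" where
  "mean_value \<theta> y = (LINT x:value_range E|signal E \<theta> y. x)"

text \<open>This is the denominator of \<open>x_ND_at\<close>, and \<open>undisclosed_value\<close>
  below is its numerator.\<close>

definition undisclosed_mass :: "(real \<times> real \<Rightarrow> real) \<Rightarrow> real \<Rightarrow> real \<Rightarrow> real" where
  "undisclosed_mass d \<theta> y = (LINT x:value_range E|signal E \<theta> y. 1 - d (x, y))"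

definition undisclosed_value :: "(real \<times> real \<Rightarrow> real) \<Rightarrow> real \<Rightarrow> real \<Rightarrow> real" where
  "undisclosed_value d \<theta> y = (LINT x:value_range E|signal E \<theta> y. x * (1 - d (x, y)))"

text \<open>Every positive precision is a spread of precision 0, which therefore serves as the
  common reference.\<close>

lemma mean_value_eq:
  assumes "0 \<le> \<theta>" "y \<in> profit_range E"
  shows "mean_value \<theta> y = mean_value 0 y"
proof (cases "\<theta> = 0")
  case False
  then have "mean_preserving_spread (signal E \<theta> y) (signal E 0 y)"
    using signal_spread[of 0 \<theta> y] assms by simp
  then show ?thesis
    unfolding mean_value_def using assms
    by (intro set_integral_spread_eq prob_space_signal sets_signal AE_signal) auto
qed simp

lemma borel_measurable_value:
  "(\<lambda>w. fst w) \<in> borel_measurable (restrict_space borel (value_range E \<times> profit_range E))"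
  by (intro measurable_restrict_space1) (simp add: borel_prod[symmetric])

lemma abs_value_le:
  assumes "w \<in> value_range E \<times> profit_range E"
  shows "\<bar>fst w\<bar> \<le> \<bar>xmin E\<bar> + \<bar>xmax E\<bar>"
  using assms by (intro abs_le_of_mem_interval) auto

lemma disclosure_ruleD:
  assumes "d \<in> disclosure_rules E"
  shows "d \<in> borel_measurable (restrict_space borel (value_range E \<times> profit_range E))"
    and "w \<in> value_range E \<times> profit_range E \<Longrightarrow> 0 \<le> d w \<and> d w \<le> 1"
  using assms unfolding disclosure_rules_def by auto

lemma undisclosed_integrand:
  assumes d: "d \<in> disclosure_rules E"
  shows "(\<lambda>w. 1 - d w) \<in> borel_measurable (restrict_space borel (value_range E \<times> profit_range E))"
    and "w \<in> value_range E \<times> profit_range E \<Longrightarrow> \<bar>1 - d w\<bar> \<le> 1"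
    and "(\<lambda>w. fst w * (1 - d w)) \<in> borel_measurable (restrict_space borel (value_range E \<times> profit_range E))"
    and "w \<in> value_range E \<times> profit_range E \<Longrightarrow> \<bar>fst w * (1 - d w)\<bar> \<le> \<bar>xmin E\<bar> + \<bar>xmax E\<bar>"
proof -
  show m: "(\<lambda>w. 1 - d w) \<in> borel_measurable (restrict_space borel (value_range E \<times> profit_range E))"
    using disclosure_ruleD(1)[OF d] by simp
  show "(\<lambda>w. fst w * (1 - d w)) \<in> borel_measurable (restrict_space borel (value_range E \<times> profit_range E))"
    by (rule borel_measurable_times[OF borel_measurable_value m])
  assume w: "w \<in> value_range E \<times> profit_range E"
  show b: "\<bar>1 - d w\<bar> \<le> 1"
    using disclosure_ruleD(2)[OF d w] by auto
  have "\<bar>fst w\<bar> * \<bar>1 - d w\<bar> \<le> (\<bar>xmin E\<bar> + \<bar>xmax E\<bar>) * 1"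
    by (intro mult_mono abs_value_le w b) auto
  then show "\<bar>fst w * (1 - d w)\<bar> \<le> \<bar>xmin E\<bar> + \<bar>xmax E\<bar>"
    by (simp add: abs_mult)
qed

lemma undisclosed_set_integrable:
  assumes "d \<in> disclosure_rules E" "0 \<le> \<theta>" "y \<in> profit_range E"
  shows "set_integrable (signal E \<theta> y) (value_range E) (\<lambda>x. 1 - d (x, y))"
    and "set_integrable (signal E \<theta> y) (value_range E) (\<lambda>x. x * (1 - d (x, y)))"
  using set_integrable_signal[OF undisclosed_integrand(1,2)[OF assms(1)] assms(2,3)]
    set_integrable_signal[OF undisclosed_integrand(3,4)[OF assms(1)] assms(2,3)]
  by simp_all

text \<open>Integrate the bounds on \<open>x\<close> against the nonnegative weight
  \<open>1 - d (x, y)\<close>. The bounds place the ratio in \<open>value_range E\<close> and force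
  the numerator to vanish with the denominator.\<close>

lemma undisclosed_value_bounds:
  assumes "d \<in> disclosure_rules E" "0 \<le> \<theta>" "y \<in> profit_range E"
  shows "xmin E * undisclosed_mass d \<theta> y \<le> undisclosed_value d \<theta> y"
    and "undisclosed_value d \<theta> y \<le> xmax E * undisclosed_mass d \<theta> y"
    and "0 \<le> undisclosed_mass d \<theta> y"
proof -
  note int = undisclosed_set_integrable[OF assms]
  have d: "0 \<le> d (x, y) \<and> d (x, y) \<le> 1" if "x \<in> value_range E" for x
    using disclosure_ruleD(2)[OF assms(1), of "(x, y)"] that assms(3) by simp
  have "(LINT x:value_range E|signal E \<theta> y. xmin E * (1 - d (x, y))) \<le> undisclosed_value d \<theta> y"
    unfolding undisclosed_value_def using int d
    by (intro set_integral_mono set_integrable_mult_right mult_right_mono) auto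
  then show "xmin E * undisclosed_mass d \<theta> y \<le> undisclosed_value d \<theta> y"
    by (simp add: undisclosed_mass_def)
  have "undisclosed_value d \<theta> y \<le> (LINT x:value_range E|signal E \<theta> y. xmax E * (1 - d (x, y)))"
    unfolding undisclosed_value_def using int d
    by (intro set_integral_mono set_integrable_mult_right mult_right_mono) auto
  then show "undisclosed_value d \<theta> y \<le> xmax E * undisclosed_mass d \<theta> y"
    by (simp add: undisclosed_mass_def)
  have "(LINT x:value_range E|signal E \<theta> y. 0) \<le> undisclosed_mass d \<theta> y"
    unfolding undisclosed_mass_def using int(1) d
    by (intro set_integral_mono) (auto simp: set_integrable_def)
  then show "0 \<le> undisclosed_mass d \<theta> y"
    by simp
qed

text \<open>This licenses the affine formula at \<open>x_ND_at\<close>, since demand is known to be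
  affine only on \<open>value_range E\<close>.\<close>

lemma x_ND_at_range:
  assumes "d \<in> disclosure_rules E" "0 \<le> \<theta>" "y \<in> profit_range E"
  shows "x_ND_at E d \<theta> y \<in> value_range E"
proof (cases "undisclosed_mass d \<theta> y = 0")
  case True
  then show ?thesis
    using offpath_at_range[OF assms(3)] by (simp add: x_ND_at_def undisclosed_mass_def)
next
  case False
  then have "x_ND_at E d \<theta> y = undisclosed_value d \<theta> y / undisclosed_mass d \<theta> y"
    by (simp add: x_ND_at_def undisclosed_mass_def undisclosed_value_def)
  moreover have "0 < undisclosed_mass d \<theta> y"
    using False undisclosed_value_bounds(3)[OF assms] by simp
  ultimately show ?thesis
    using undisclosed_value_bounds(1,2)[OF assms]
    by (simp add: pos_le_divide_eq pos_divide_le_eq)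
qed

section \<open>Splitting of the payoff for affine demand\<close>

lemma x_ND_at_mult_mass:
  assumes "d \<in> disclosure_rules E" "0 \<le> \<theta>" "y \<in> profit_range E"
  shows "x_ND_at E d \<theta> y * undisclosed_mass d \<theta> y = undisclosed_value d \<theta> y"
proof (cases "undisclosed_mass d \<theta> y = 0")
  case True
  then show ?thesis
    \<comment> \<open>With zero mass the two bounds squeeze the undisclosed value to 0, so the
      identity holds whatever the off-path value is.\<close>
    using undisclosed_value_bounds[OF assms] by simp
next
  case False
  then show ?thesis
    by (simp add: x_ND_at_def undisclosed_mass_def undisclosed_value_def)
qed

text \<open>The interim payoff difference between pooling undisclosed objects across all \<open>y\<close> and
  disclosing them, for the affine demand \<open>x \<mapsto> a + b x\<close>.\<close>

definition pooling_gain :: "real \<Rightarrow> real \<Rightarrow> (real \<times> real \<Rightarrow> real) \<Rightarrow> real \<Rightarrow> real \<Rightarrow> real" where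
  "pooling_gain a b d \<theta> y =
     (demand E (x_ND E d \<theta>) - a) * undisclosed_mass d \<theta> y - b * undisclosed_value d \<theta> y"

text \<open>By \<open>x_ND_at_mult_mass\<close>, paying
  \<open>a + b * x_ND_at E d \<theta> y\<close> on the undisclosed mass yields what disclosure would
  yield there. So the share \<tau> adds nothing to the full-disclosure payoff
  \<open>a + b * mean_value \<theta> y\<close>, and only the share \<open>1 - \<tau>\<close> leaves
  a difference.\<close>

lemma interim_payoff_eq:
  assumes affine: "\<forall>x \<in> value_range E. demand E x = a + b * x"
    and d: "d \<in> disclosure_rules E" and \<theta>: "0 \<le> \<theta>" and y: "y \<in> profit_range E"
  shows "(LINT x:value_range E|signal E \<theta> y.
       d (x, y) * demand E x +
       (1 - d (x, y)) * (\<tau> * demand E (x_ND_at E d \<theta> y) + (1 - \<tau>) * demand E (x_ND E d \<theta>)))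
     = a + b * mean_value \<theta> y + (1 - \<tau>) * pooling_gain a b d \<theta> y"
    (is "(LINT x:_|_. ?f x) = _")
proof -
  define C where "C = \<tau> * demand E (x_ND_at E d \<theta> y) + (1 - \<tau>) * demand E (x_ND E d \<theta>)"
  let ?S = "signal E \<theta> y" and ?V = "value_range E"
  interpret prob_space ?S
    using prob_space_signal[OF \<theta> y] .
  note int = undisclosed_set_integrable[OF d \<theta> y]
  have id: "set_integrable ?S ?V (\<lambda>x. x)"
    using set_integrable_signal[OF borel_measurable_value abs_value_le \<theta> y] by simp
  have const: "set_integrable ?S ?V (\<lambda>x. a)"
    using set_integrable_signal[of "\<lambda>_. a" "\<bar>a\<bar>", OF _ _ \<theta> y] by simp
  \<comment> \<open>The integrand is the full-disclosure payoff plus a correction on undisclosed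
    realizations. \<open>C\<close> is constant in \<open>x\<close>, so each term integrates to a
    named quantity.\<close>
  have "(LINT x:?V|?S. ?f x) =
      (LINT x:?V|?S. (a + b * x + (C - a) * (1 - d (x, y))) - b * (x * (1 - d (x, y))))"
    using sets_signal[OF \<theta> y]
    by (intro set_lebesgue_integral_cong) (auto simp flip: C_def simp: affine[rule_format], simp add: algebra_simps)
  also have "\<dots> = (LINT x:?V|?S. a) + b * mean_value \<theta> y
      + (C - a) * undisclosed_mass d \<theta> y - b * undisclosed_value d \<theta> y"
    unfolding mean_value_def undisclosed_mass_def undisclosed_value_def
    using id const int by (simp add: set_integral_add set_integral_diff)
  also have "(LINT x:?V|?S. a) = a"
    using set_integral_const[of ?V ?S a] measure_signal_value_range[OF \<theta> y] sets_signal[OF \<theta> y]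
    by simp
  \<comment> \<open>The affine formula is applied at \<open>x_ND_at\<close> only; the demand at
    \<open>x_ND\<close> stays a single number, as in \<open>pooling_gain\<close>.\<close>
  also have "C - a = \<tau> * b * x_ND_at E d \<theta> y + (1 - \<tau>) * (demand E (x_ND E d \<theta>) - a)"
    unfolding C_def bspec[OF affine x_ND_at_range[OF d \<theta> y]] by (simp add: algebra_simps)
  finally show ?thesis
    unfolding pooling_gain_def x_ND_at_mult_mass[OF d \<theta> y, symmetric] by (simp add: algebra_simps)
qed

text \<open>Weight the interim identity by \<open>y\<close> and integrate. Replacing the mean value
  by the one at precision 0 frees the first term of \<open>d\<close>, \<theta> and \<tau>.\<close>

lemma gross_payoff_eq:
  assumes affine: "\<forall>x \<in> value_range E. demand E x = a + b * x"
    and d: "d \<in> disclosure_rules E" and \<theta>: "0 \<le> \<theta>"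
  shows "gross_payoff E \<tau> d \<theta> =
      (LINT y:profit_range E|profit_law E. y * (a + b * mean_value 0 y)) +
      (1 - \<tau>) * (LINT y:profit_range E|profit_law E. y * pooling_gain a b d \<theta> y)"
proof -
  let ?Y = "profit_range E" and ?P = "profit_law E" and ?p = "demand E (x_ND E d \<theta>)"
  interpret prob_space ?P
    by (rule prob_space_profit_law)
  have mean: "set_integrable ?P ?Y (\<lambda>y. y * mean_value 0 y)"
    using set_integrable_profit_law[OF borel_measurable_value abs_value_le order_refl]
    by (simp add: mean_value_def)
  have mass: "set_integrable ?P ?Y (\<lambda>y. y * undisclosed_mass d \<theta> y)"
    using set_integrable_profit_law[OF undisclosed_integrand(1,2)[OF d] \<theta>]
    by (simp add: undisclosed_mass_def)
  have val: "set_integrable ?P ?Y (\<lambda>y. y * undisclosed_value d \<theta> y)"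
    using set_integrable_profit_law[OF undisclosed_integrand(3,4)[OF d] \<theta>]
    by (simp add: undisclosed_value_def)
  have id: "set_integrable ?P ?Y (\<lambda>y. y)"
    unfolding set_integrable_def
    by (rule integrable_const_bound[where B = "\<bar>ymin E\<bar> + \<bar>ymax E\<bar>"])
      (auto split: split_indicator simp: measurable_cong_sets[OF sets_profit_law refl])
  have K: "set_integrable ?P ?Y (\<lambda>y. y * (a + b * mean_value 0 y))"
    using set_integral_add(1)[OF set_integrable_mult_right[of a, OF id]
        set_integrable_mult_right[of b, OF mean]]
    by (simp add: algebra_simps)
  have G: "set_integrable ?P ?Y (\<lambda>y. y * pooling_gain a b d \<theta> y)"
    using set_integral_diff(1)[OF set_integrable_mult_right[of "?p - a", OF mass]
        set_integrable_mult_right[of b, OF val]]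
    by (simp add: pooling_gain_def algebra_simps)
  have "gross_payoff E \<tau> d \<theta> =
      (LINT y:?Y|?P. y * (a + b * mean_value 0 y) + (1 - \<tau>) * (y * pooling_gain a b d \<theta> y))"
    unfolding gross_payoff_def
  proof (intro set_lebesgue_integral_cong allI impI, goal_cases)
    case 1
    show ?case
      by (simp add: sets_profit_law)
  next
    case (2 y)
    show ?case
      unfolding interim_payoff_eq[OF affine d \<theta> 2] mean_value_eq[OF \<theta> 2] by (simp add: algebra_simps)
  qed
  then show ?thesis
    using K G by (simp add: set_integral_add)
qed

end

section \<open>Comparison of optimal precisions across transparency policies\<close>

theorem proposition4:
  fixes E :: env
  assumes "disclosure_env E"
    and "\<exists>a b. \<forall>x \<in> value_range E. demand E x = a + b * x"
  shows "(\<forall>\<theta>. optimally_acquired E 1 \<theta> \<longleftrightarrow> \<theta> = 0) \<and>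
    (\<forall>\<tau> \<in> {0..1}. \<forall>\<tau>' \<in> {0..1}. \<forall>\<theta> \<theta>'.
       \<tau>' < \<tau> \<and> optimally_acquired E \<tau> \<theta> \<and> optimally_acquired E \<tau>' \<theta>' \<longrightarrow> \<theta> \<le> \<theta>')"
proof -
  interpret disclosure_env E by fact
  obtain a b where affine: "\<forall>x \<in> value_range E. demand E x = a + b * x"
    using assms(2) by blast
  define K where "K = (LINT y:profit_range E|profit_law E. y * (a + b * mean_value 0 y))"
  define G where "G d \<theta> = (LINT y:profit_range E|profit_law E. y * pooling_gain a b d \<theta> y)" for d \<theta>
  have payoff: "gross_payoff E \<tau> d \<theta> = K + (1 - \<tau>) * G d \<theta>"
    if "d \<in> disclosure_rules E" "0 \<le> \<theta>" for \<tau> d \<theta>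
    unfolding K_def G_def by (rule gross_payoff_eq[OF affine that])
  have cost_le_iff: "cost E \<theta> \<le> cost E \<theta>' \<longleftrightarrow> \<theta> \<le> \<theta>'" if "0 \<le> \<theta>" "0 \<le> \<theta>'" for \<theta> \<theta>'
    using strict_mono_on_less_eq[OF cost_strict_mono] that by simp
  \<comment> \<open>The constant \<open>K\<close> cancels from both sides of the optimality
    inequality.\<close>
  have opt_iff: "optimally_acquired E \<tau> \<theta> \<longleftrightarrow> 0 \<le> \<theta> \<and>
      (\<exists>d \<in> disclosure_rules E. \<forall>d' \<in> disclosure_rules E. \<forall>\<theta>' \<ge> 0.
         (1 - \<tau>) * G d' \<theta>' - cost E \<theta>' \<le> (1 - \<tau>) * G d \<theta> - cost E \<theta>)" for \<tau> \<theta>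
    unfolding optimally_acquired_def by (auto simp: payoff intro!: conj_cong bex_cong)
  \<comment> \<open>Some rule must exist to compare with precision 0 and to attain the maximum
    there; at full transparency any rule will do.\<close>
  have ex_rule: "(\<lambda>_. 0) \<in> disclosure_rules E"
    by (simp add: disclosure_rules_def)
  have "optimally_acquired E 1 \<theta> \<longleftrightarrow> \<theta> = 0" for \<theta>
  proof
    assume "optimally_acquired E 1 \<theta>"
    then have "0 \<le> \<theta>" "cost E \<theta> \<le> cost E 0"
      using ex_rule by (auto simp: opt_iff)
    then show "\<theta> = 0"
      by (simp add: cost_le_iff)
  next
    assume "\<theta> = 0"
    then show "optimally_acquired E 1 \<theta>"
      using ex_rule by (auto simp: opt_iff cost_le_iff)
  qed
  moreover have "\<theta> \<le> \<theta>'"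
    if \<tau>: "\<tau> \<in> {0..1}" "\<tau>' < \<tau>" and opt: "optimally_acquired E \<tau> \<theta>" "optimally_acquired E \<tau>' \<theta>'"
    for \<tau> \<tau>' \<theta> \<theta>'
  proof -
    obtain d where d: "0 \<le> \<theta>" "d \<in> disclosure_rules E"
      "\<And>d' \<theta>'. d' \<in> disclosure_rules E \<Longrightarrow> 0 \<le> \<theta>' \<Longrightarrow>
         (1 - \<tau>) * G d' \<theta>' - cost E \<theta>' \<le> (1 - \<tau>) * G d \<theta> - cost E \<theta>"
      using opt(1) unfolding opt_iff by blast
    obtain d' where d': "0 \<le> \<theta>'" "d' \<in> disclosure_rules E"
      "\<And>d \<theta>. d \<in> disclosure_rules E \<Longrightarrow> 0 \<le> \<theta> \<Longrightarrow>
         (1 - \<tau>') * G d \<theta> - cost E \<theta> \<le> (1 - \<tau>') * G d' \<theta>' - cost E \<theta>'"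
      using opt(2) unfolding opt_iff by blast
    \<comment> \<open>Each optimum is tested against the other one; in the sum of the two
      inequalities the costs cancel.\<close>
    note le = d(3)[OF d'(2,1)] and le' = d'(3)[OF d(2,1)]
    from le le' have "0 \<le> (\<tau> - \<tau>') * (G d' \<theta>' - G d \<theta>)"
      by (simp add: algebra_simps)
    then have "G d \<theta> \<le> G d' \<theta>'"
      using \<tau>(2) by (simp add: zero_le_mult_iff)
    \<comment> \<open>The bound \<open>\<tau> \<le> 1\<close> keeps the factor nonnegative; at
      \<open>\<tau> = 1\<close> both sides are 0.\<close>
    then have "(1 - \<tau>) * G d \<theta> \<le> (1 - \<tau>) * G d' \<theta>'"
      using \<tau>(1) by (intro mult_left_mono) auto
    with le have "cost E \<theta> \<le> cost E \<theta>'"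
      by simp
    then show ?thesis
      by (simp add: cost_le_iff d(1) d'(1))
  qed
  ultimately show ?thesis
    by blast
qed

end
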